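(* Let $0<\alpha\le\beta$, $\kappa=\beta/\alpha$, and let $n\ge 2$ and $d\ge 1$ be integers. Let $f_1,\dots,f_{n-1},f_{\mathrm{a}},f_{\mathrm{b}}\in\mathcal{F}_{\alpha,\beta}$ be functions on $\mathbb{R}^d$, and define $$x^{\mathrm{a}}=\arg\min_{x\in\mathbb{R}^d}\big(f_1(x)+\dots+f_{n-1}(x)+f_{\mathrm{a}}(x)\big),\qquad x^{\mathrm{b}}=\arg\min_{x\in\mathbb{R}^d}\big(f_1(x)+\dots+f_{n-1}(x)+f_{\mathrm{b}}(x)\big).$$ Then $$\|x^{\mathrm{a}}-x^{\mathrm{b}}\|\le\min\left(4+4\sqrt{\kappa},\ \frac{4\sqrt{\kappa}+2\kappa}{\sqrt{n-1}},\ \frac{4\kappa+2\kappa^{3/2}}{n}\right).$$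
   Context: $\|\cdot\|$ is the Euclidean norm. $\mathcal{F}_{\alpha,\beta}$ is the set of continuously differentiable functions $g:\mathbb{R}^d\to\mathbb{R}$ such that: $g$ is $\alpha$-strongly convex (i.e. $g(x)-\frac{\alpha}{2}\|x\|^2$ is convex); $g$ is $\beta$-smooth (i.e. $\|\nabla g(x)-\nabla g(y)\|\le\beta\|x-y\|$ for all $x,y$); $\min_x g(x)=0$; and the minimizer of $g$ has norm at most $1$. *)

theory Defs
  imports "HOL-Analysis.Analysis"
begin

definition strongly_convex :: "real \<Rightarrow> (real ^ 'd \<Rightarrow> real) \<Rightarrow> bool" where
  "strongly_convex \<alpha> g \<longleftrightarrow> convex_on UNIV (\<lambda>x. g x - \<alpha> / 2 * (norm x)\<^sup>2)"

definition is_gradient :: "(real ^ 'd \<Rightarrow> real) \<Rightarrow> (real ^ 'd \<Rightarrow> real ^ 'd) \<Rightarrow> bool" where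
  "is_gradient g g' \<longleftrightarrow> (\<forall>x. GDERIV g x :> g' x)"

text \<open>The last two conjuncts say that the minimum of \<open>g\<close> is attained with value \<open>0\<close>, and that
  the minimizer, which is unique when \<open>0 < \<alpha>\<close>, lies in the closed unit ball.\<close>

definition F_class :: "real \<Rightarrow> real \<Rightarrow> (real ^ 'd \<Rightarrow> real) set" where
  "F_class \<alpha> \<beta> = {g.
     (\<exists>g'. is_gradient g g' \<and> continuous_on UNIV g' \<and>
           (\<forall>x y. norm (g' x - g' y) \<le> \<beta> * norm (x - y))) \<and>
     strongly_convex \<alpha> g \<and>
     (\<exists>z. is_arg_min g (\<lambda>_. True) z \<and> g z = 0) \<and>
     (\<forall>z. is_arg_min g (\<lambda>_. True) z \<longrightarrow> norm z \<le> 1)}"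

end

theory Submission
  imports Defs
begin

text \<open>
  A sum of \<open>n\<close> functions of the class is \<open>n \<alpha>\<close>-strongly convex. Each summand is at most \<open>\<beta> / 2\<close> at
  the origin and at least \<open>\<alpha> (\<parallel>x\<parallel> - 1)\<^sup>2 / 2\<close> outside the unit ball, so the minimizer of the sum has
  norm at most \<open>1 + \<surd>\<kappa>\<close>. This gives the first bound. Adding the quadratic growth inequalities of the
  two sums at \<open>x\<^sup>a\<close> and \<open>x\<^sup>b\<close> cancels the common summands and leaves
  \<open>n \<alpha> \<parallel>x\<^sup>a - x\<^sup>b\<parallel>\<^sup>2 \<le> (f\<^sub>b x\<^sup>a - f\<^sub>b x\<^sup>b) + (f\<^sub>a x\<^sup>b - f\<^sub>a x\<^sup>a)\<close>. Bounding the right-hand side by function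
  values gives the \<open>1 / \<surd>n\<close> rate, bounding it by gradients gives the \<open>1 / n\<close> rate.
\<close>

lemma is_arg_min_exists_if_bounded_sublevel:
  fixes g :: "'a::heine_borel \<Rightarrow> real"
  assumes "continuous_on UNIV g" "bounded {x. g x \<le> g a}"
  shows "\<exists>z. is_arg_min g (\<lambda>_. True) z"
proof -
  have "closed {x. g x \<le> g a}"
    using assms(1) by (intro closed_Collect_le) auto
  then have "compact {x. g x \<le> g a}"
    using assms(2) by (simp add: compact_eq_bounded_closed)
  then obtain z where z: "g z \<le> g a" "\<And>x. g x \<le> g a \<Longrightarrow> g z \<le> g x"
    using continuous_attains_inf[of "{x. g x \<le> g a}" g] continuous_on_subset[OF assms(1)] by auto
  have "g z \<le> g x" for x
    using z(1) z(2)[of x] by linarith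
  then show ?thesis
    by (auto simp: is_arg_min_linorder)
qed

lemma GDERIV_eq_0_at_arg_min:
  assumes "GDERIV g z :> D" "is_arg_min g (\<lambda>_. True) z"
  shows "D = 0"
proof -
  have "(\<lambda>h. h \<bullet> D) = (\<lambda>h. 0)"
    using assms by (intro differential_zero_maxmin[where S = UNIV])
      (auto simp: gderiv_def is_arg_min_linorder)
  then show ?thesis
    by (metis inner_eq_zero_iff)
qed

lemma GDERIV_along_line:
  assumes "GDERIV g (x + t *\<^sub>R v) :> D"
  shows "((\<lambda>t. g (x + t *\<^sub>R v)) has_real_derivative D \<bullet> v) (at t)"
proof -
  have "((\<lambda>t. x + t *\<^sub>R v) has_derivative (\<lambda>s. s *\<^sub>R v)) (at t)"
    by (auto intro!: derivative_eq_intros)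
  then have "((\<lambda>t. g (x + t *\<^sub>R v)) has_derivative (\<lambda>s. (s *\<^sub>R v) \<bullet> D)) (at t)"
    using assms unfolding gderiv_def by (rule has_derivative_compose)
  then show ?thesis
    unfolding has_field_derivative_def
    by (rule has_derivative_eq_rhs) (simp add: fun_eq_iff inner_commute)
qed

lemma bounded_GDERIV_imp_lipschitz:
  assumes "convex S" "0 \<le> L"
    and GDERIV: "\<And>x. x \<in> S \<Longrightarrow> GDERIV g x :> g' x"
    and bound: "\<And>x. x \<in> S \<Longrightarrow> norm (g' x) \<le> L"
  shows "L-lipschitz_on S g"
proof (rule bounded_derivative_imp_lipschitz[OF _ assms(1) _ assms(2)])
  fix x assume x: "x \<in> S"
  show "(g has_derivative (\<lambda>h. h \<bullet> g' x)) (at x within S)"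
    using GDERIV[OF x] by (simp add: gderiv_def has_derivative_at_withinI)
  have "norm (h \<bullet> g' x) \<le> L * norm h" for h
    using Cauchy_Schwarz_ineq2[of h "g' x"] mult_left_mono[OF bound[OF x] norm_ge_zero[of h]]
    by (simp add: mult.commute)
  then show "onorm (\<lambda>h. h \<bullet> g' x) \<le> L"
    by (rule onorm_bound[OF assms(2)])
qed

lemma lipschitz_GDERIV_upper_bound:
  assumes S: "convex S" "x \<in> S" "y \<in> S"
    and GDERIV: "\<And>u. u \<in> S \<Longrightarrow> GDERIV g u :> g' u"
    and lipschitz: "\<beta>-lipschitz_on S g'"
  shows "g y \<le> g x + g' x \<bullet> (y - x) + \<beta> / 2 * (norm (y - x))\<^sup>2"
proof -
  define v where "v = y - x"
  define \<phi> where "\<phi> = (\<lambda>t. g (x + t *\<^sub>R v) - t * (g' x \<bullet> v) - \<beta> / 2 * t\<^sup>2 * (norm v)\<^sup>2)"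
  define \<phi>' where "\<phi>' = (\<lambda>t. g' (x + t *\<^sub>R v) \<bullet> v - g' x \<bullet> v - \<beta> * t * (norm v)\<^sup>2)"
  have mem: "x + t *\<^sub>R v \<in> S" if "0 \<le> t" "t \<le> 1" for t
    using convexD_alt[OF S that] by (simp add: v_def algebra_simps)
  have deriv: "(\<phi> has_real_derivative \<phi>' t) (at t)" if "0 \<le> t" "t \<le> 1" for t
    unfolding \<phi>_def \<phi>'_def
    by (rule derivative_eq_intros GDERIV_along_line[OF GDERIV[OF mem[OF that]]] refl | simp)+
  have "\<phi>' t \<le> 0" if "0 \<le> t" "t \<le> 1" for t
  proof -
    have "(g' (x + t *\<^sub>R v) - g' x) \<bullet> v \<le> norm (g' (x + t *\<^sub>R v) - g' x) * norm v"
      by (rule norm_cauchy_schwarz)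
    also have "\<dots> \<le> \<beta> * norm (t *\<^sub>R v) * norm v"
      using lipschitz_on_normD[OF lipschitz mem[OF that] S(2)] by (intro mult_right_mono) simp_all
    finally show ?thesis
      using that by (simp add: \<phi>'_def inner_diff_left power2_eq_square mult.assoc)
  qed
  then have "\<phi> 1 \<le> \<phi> 0"
    using deriv by (intro DERIV_nonpos_imp_nonincreasing[of 0 1 \<phi>]) auto
  then show ?thesis
    by (simp add: \<phi>_def v_def)
qed

lemma strongly_convexD:
  fixes g :: "real ^ 'd \<Rightarrow> real"
  assumes "strongly_convex \<alpha> g" "0 \<le> t" "t \<le> 1"
  shows "g ((1 - t) *\<^sub>R x + t *\<^sub>R y)
    \<le> (1 - t) * g x + t * g y - \<alpha> / 2 * (t * (1 - t) * (norm (x - y))\<^sup>2)"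
proof -
  have norm_eq: "(norm ((1 - t) *\<^sub>R x + t *\<^sub>R y))\<^sup>2
      = (1 - t) * (norm x)\<^sup>2 + t * (norm y)\<^sup>2 - t * (1 - t) * (norm (x - y))\<^sup>2"
    unfolding power2_norm_eq_inner by (simp add: inner_commute[of y x] algebra_simps)
  have "g ((1 - t) *\<^sub>R x + t *\<^sub>R y) - \<alpha> / 2 * (norm ((1 - t) *\<^sub>R x + t *\<^sub>R y))\<^sup>2
      \<le> (1 - t) * (g x - \<alpha> / 2 * (norm x)\<^sup>2) + t * (g y - \<alpha> / 2 * (norm y)\<^sup>2)"
    by (rule convex_onD[OF assms(1)[unfolded strongly_convex_def] assms(2,3) UNIV_I UNIV_I])
  then show ?thesis
    unfolding norm_eq by (simp add: algebra_simps diff_divide_distrib)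
qed

lemma strongly_convex_add:
  assumes "strongly_convex \<alpha> g" "strongly_convex \<beta> h"
  shows "strongly_convex (\<alpha> + \<beta>) (\<lambda>x. g x + h x)"
  using convex_on_add[OF assms[unfolded strongly_convex_def]]
  by (simp add: strongly_convex_def algebra_simps add_divide_distrib)

lemma strongly_convex_sum:
  fixes g :: "'i \<Rightarrow> real ^ 'd \<Rightarrow> real"
  assumes "finite S" "\<And>i. i \<in> S \<Longrightarrow> strongly_convex (\<alpha> i) (g i)"
  shows "strongly_convex (\<Sum>i\<in>S. \<alpha> i) (\<lambda>x. \<Sum>i\<in>S. g i x)"
  using assms
proof (induction S rule: finite_induct)
  case empty
  then show ?case by (simp add: strongly_convex_def convex_on_const)
next
  case (insert i S)
  then show ?case by (simp add: strongly_convex_add)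
qed

lemma strongly_convex_imp_continuous:
  fixes g :: "real ^ 'd \<Rightarrow> real"
  assumes "strongly_convex \<alpha> g"
  shows "continuous_on UNIV g"
proof -
  have "continuous_on UNIV (\<lambda>x. g x - \<alpha> / 2 * (norm x)\<^sup>2)"
    using assms unfolding strongly_convex_def by (rule convex_on_continuous[OF open_UNIV])
  then have "continuous_on UNIV (\<lambda>x. (g x - \<alpha> / 2 * (norm x)\<^sup>2) + \<alpha> / 2 * (norm x)\<^sup>2)"
    by (rule continuous_on_add) (intro continuous_intros)
  then show ?thesis by simp
qed

lemma strongly_convex_growth_from_unit_sphere:
  fixes g :: "real ^ 'd \<Rightarrow> real"
  assumes "strongly_convex \<alpha> g" "1 \<le> dist x y"
    and sphere: "\<And>u. dist x u = 1 \<Longrightarrow> m \<le> g u"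
  shows "g x + dist x y * (m - g x + \<alpha> / 2 * (dist x y - 1)) \<le> g y"
proof -
  define r where "r = dist x y"
  define t where "t = 1 / r"
  have "1 \<le> r"
    using assms(2) by (simp add: r_def)
  then have r: "0 < r" and t: "0 \<le> t" "t \<le> 1" "t * r = 1"
    by (simp_all add: t_def)
  have "dist x ((1 - t) *\<^sub>R x + t *\<^sub>R y) = t * r"
    using t(1) norm_scaleR[of t "x - y"] by (simp add: r_def dist_norm algebra_simps)
  then have "m \<le> g ((1 - t) *\<^sub>R x + t *\<^sub>R y)"
    using t(3) by (intro sphere) simp
  also have "\<dots> \<le> (1 - t) * g x + t * g y - \<alpha> / 2 * (t * (1 - t) * r\<^sup>2)"
    using strongly_convexD[OF assms(1) t(1,2), of x y] by (simp add: r_def dist_norm)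
  also have "t * (1 - t) * r\<^sup>2 = r - 1"
    using r by (simp add: t_def power2_eq_square field_simps)
  finally have "m \<le> (1 - t) * g x + t * g y - \<alpha> / 2 * (r - 1)" .
  then have "r * m \<le> r * ((1 - t) * g x + t * g y - \<alpha> / 2 * (r - 1))"
    using r by simp
  also have "\<dots> = (r - 1) * g x + g y - r * (\<alpha> / 2 * (r - 1))"
    using r by (simp add: t_def field_simps)
  finally show ?thesis
    by (simp add: r_def[symmetric] algebra_simps)
qed

lemma strongly_convex_bounded_sublevel:
  fixes g :: "real ^ 'd \<Rightarrow> real"
  assumes "0 < \<alpha>" "strongly_convex \<alpha> g"
  shows "bounded {y. g y \<le> g x}"
proof -
  have "\<exists>w\<in>cball x 1. \<forall>u\<in>cball x 1. g w \<le> g u"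
    using strongly_convex_imp_continuous[OF assms(2)]
    by (intro continuous_attains_inf) (auto intro: continuous_on_subset)
  then obtain m where m: "\<And>u. u \<in> cball x 1 \<Longrightarrow> m \<le> g u"
    by blast
  have "dist x y \<le> 1 + 2 * (g x - m) / \<alpha>" if y: "g y \<le> g x" for y
  proof (cases "dist x y \<le> 1")
    case True
    then show ?thesis using m[of x] assms(1) by (simp add: add_increasing2)
  next
    case False
    then have "dist x y * (m - g x + \<alpha> / 2 * (dist x y - 1)) \<le> 0"
      using strongly_convex_growth_from_unit_sphere[OF assms(2), of x y m] m y by simp
    then have "m - g x + \<alpha> / 2 * (dist x y - 1) \<le> 0"
      using False by (auto simp: mult_le_0_iff)
    then show ?thesis
      using assms(1) by (simp add: field_simps)
  qed
  then show ?thesis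
    unfolding bounded_def by blast
qed

lemma strongly_convex_is_arg_min:
  fixes g :: "real ^ 'd \<Rightarrow> real"
  assumes "0 < \<alpha>" "strongly_convex \<alpha> g"
  shows "is_arg_min g (\<lambda>_. True) (arg_min g (\<lambda>_. True))"
proof -
  have "\<exists>z. is_arg_min g (\<lambda>_. True) z"
    using strongly_convex_imp_continuous[OF assms(2)] strongly_convex_bounded_sublevel[OF assms]
    by (rule is_arg_min_exists_if_bounded_sublevel)
  then show ?thesis
    unfolding arg_min_def by (rule someI_ex)
qed

lemma strongly_convex_growth_at_arg_min:
  fixes g :: "real ^ 'd \<Rightarrow> real"
  assumes "strongly_convex \<alpha> g" "is_arg_min g (\<lambda>_. True) z"
  shows "g z + \<alpha> / 2 * (norm (z - y))\<^sup>2 \<le> g y"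
proof -
  have "s * (\<alpha> / 2 * (norm (z - y))\<^sup>2) \<le> g y - g z" if s: "0 < s" "s < 1" for s
  proof -
    have "g z \<le> g (s *\<^sub>R z + (1 - s) *\<^sub>R y)"
      using assms(2) by (simp add: is_arg_min_linorder)
    also have "\<dots> \<le> s * g z + (1 - s) * g y - \<alpha> / 2 * ((1 - s) * s * (norm (z - y))\<^sup>2)"
      using strongly_convexD[OF assms(1), of "1 - s" z y] s by simp
    finally have "(1 - s) * (s * (\<alpha> / 2 * (norm (z - y))\<^sup>2)) \<le> (1 - s) * (g y - g z)"
      by (simp add: algebra_simps diff_divide_distrib)
    then show ?thesis
      using s(2) by simp
  qed
  then have "\<alpha> / 2 * (norm (z - y))\<^sup>2 \<le> g y - g z"
    by (rule field_le_mult_one_interval)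
  then show ?thesis by simp
qed

definition exchange_gap :: "('a \<Rightarrow> real) \<Rightarrow> ('a \<Rightarrow> real) \<Rightarrow> 'a \<Rightarrow> 'a \<Rightarrow> real" where
  "exchange_gap g h x y = (h x - h y) + (g y - g x)"

lemma strongly_convex_arg_min_exchange:
  fixes F g h :: "real ^ 'd \<Rightarrow> real"
  assumes "strongly_convex \<mu> (\<lambda>x. F x + g x)" "strongly_convex \<mu> (\<lambda>x. F x + h x)"
    and "is_arg_min (\<lambda>x. F x + g x) (\<lambda>_. True) x" "is_arg_min (\<lambda>x. F x + h x) (\<lambda>_. True) y"
  shows "\<mu> * (norm (x - y))\<^sup>2 \<le> exchange_gap g h x y"
  using strongly_convex_growth_at_arg_min[OF assms(1,3), of y]
    strongly_convex_growth_at_arg_min[OF assms(2,4), of x]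
  by (simp add: exchange_gap_def norm_minus_commute[of y x])

lemma F_classE:
  fixes g :: "real ^ 'd \<Rightarrow> real"
  assumes "g \<in> F_class \<alpha> \<beta>"
  obtains g' z where "\<And>x. GDERIV g x :> g' x" "\<beta>-lipschitz_on UNIV g'"
    "is_arg_min g (\<lambda>_. True) z" "g z = 0" "norm z \<le> 1" "g' z = 0"
proof -
  obtain g' z where g': "\<And>x. GDERIV g x :> g' x" "\<And>x y. norm (g' x - g' y) \<le> \<beta> * norm (x - y)"
    and z: "is_arg_min g (\<lambda>_. True) z" "g z = 0" "norm z \<le> 1"
    using assms unfolding F_class_def is_gradient_def by blast
  have "0 \<le> \<beta>"
    using order_trans[OF norm_ge_zero g'(2)[of "axis undefined 1" 0]] by simp
  then have "\<beta>-lipschitz_on UNIV g'"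
    using g'(2) by (intro lipschitz_onI) (simp_all add: dist_norm)
  then show thesis
    using that g'(1) z GDERIV_eq_0_at_arg_min by blast
qed

lemma F_class_imp_strongly_convex:
  "g \<in> F_class \<alpha> \<beta> \<Longrightarrow> strongly_convex \<alpha> g"
  by (simp add: F_class_def)

lemma F_class_smoothness_nonneg:
  "g \<in> F_class \<alpha> \<beta> \<Longrightarrow> 0 \<le> \<beta>"
  by (elim F_classE) (rule lipschitz_on_nonneg)

lemma F_class_nonneg:
  "g \<in> F_class \<alpha> \<beta> \<Longrightarrow> 0 \<le> g x"
  by (elim F_classE) (metis is_arg_min_linorder)

lemma F_class_le_on_cball:
  assumes "g \<in> F_class \<alpha> \<beta>" "norm x \<le> r"
  shows "g x \<le> \<beta> / 2 * (r + 1)\<^sup>2"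
  using assms(1)
proof (rule F_classE)
  fix g' z
  assume GDERIV: "\<And>x. GDERIV g x :> g' x" and lipschitz: "\<beta>-lipschitz_on UNIV g'"
    and z: "g z = 0" "norm z \<le> 1" "g' z = 0"
  have "norm (x - z) \<le> r + 1"
    using norm_triangle_ineq4[of x z] assms(2) z(2) by linarith
  then have "\<beta> / 2 * (norm (x - z))\<^sup>2 \<le> \<beta> / 2 * (r + 1)\<^sup>2"
    using F_class_smoothness_nonneg[OF assms(1)] by (intro mult_left_mono power_mono) auto
  then show ?thesis
    using lipschitz_GDERIV_upper_bound[OF convex_UNIV UNIV_I UNIV_I GDERIV lipschitz, of x z] z
    by simp
qed

lemma F_class_lipschitz_on_cball:
  assumes "g \<in> F_class \<alpha> \<beta>" "0 \<le> r"
  shows "(\<beta> * (r + 1))-lipschitz_on (cball 0 r) g"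
  using assms(1)
proof (rule F_classE)
  fix g' z
  assume GDERIV: "\<And>x. GDERIV g x :> g' x" and lipschitz: "\<beta>-lipschitz_on UNIV g'"
    and z: "norm z \<le> 1" "g' z = 0"
  have \<beta>: "0 \<le> \<beta>"
    by (rule F_class_smoothness_nonneg[OF assms(1)])
  have "norm (g' x) \<le> \<beta> * (r + 1)" if "x \<in> cball 0 r" for x
  proof -
    have "norm (g' x) \<le> \<beta> * norm (x - z)"
      using lipschitz_on_normD[OF lipschitz, of x z] z(2) by simp
    also have "norm (x - z) \<le> r + 1"
      using norm_triangle_ineq4[of x z] that z(1) by simp
    finally show ?thesis
      using \<beta> by (simp add: mult_left_mono)
  qed
  then show ?thesis
    using GDERIV \<beta> assms(2) by (intro bounded_GDERIV_imp_lipschitz[where g' = g']) auto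
qed

lemma F_class_ge_outside_unit_ball:
  assumes "g \<in> F_class \<alpha> \<beta>" "0 \<le> \<alpha>" "1 \<le> norm x"
  shows "\<alpha> / 2 * (norm x - 1)\<^sup>2 \<le> g x"
  using assms(1)
proof (rule F_classE)
  fix z
  assume z: "is_arg_min g (\<lambda>_. True) z" "g z = 0" "norm z \<le> 1"
  have "norm x - 1 \<le> norm (z - x)"
    using norm_triangle_ineq3[of z x] z(3) by linarith
  then have "\<alpha> / 2 * (norm x - 1)\<^sup>2 \<le> \<alpha> / 2 * (norm (z - x))\<^sup>2"
    using assms(2,3) by (intro mult_left_mono power_mono) auto
  then show ?thesis
    using strongly_convex_growth_at_arg_min[OF F_class_imp_strongly_convex[OF assms(1)] z(1), of x]
      z(2) by simp
qed

lemma F_class_at_0_less: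
  assumes "g \<in> F_class \<alpha> \<beta>" "0 < \<alpha>" "1 + sqrt (\<beta> / \<alpha>) < norm x"
  shows "g 0 < g x"
proof -
  have "0 \<le> \<beta> / \<alpha>"
    using F_class_smoothness_nonneg[OF assms(1)] assms(2) by simp
  have "g 0 \<le> \<beta> / 2"
    using F_class_le_on_cball[OF assms(1), of 0 0] by simp
  also have "\<dots> = \<alpha> / 2 * (sqrt (\<beta> / \<alpha>))\<^sup>2"
    using \<open>0 \<le> \<beta> / \<alpha>\<close> assms(2) by simp
  also have "\<dots> < \<alpha> / 2 * (norm x - 1)\<^sup>2"
    using \<open>0 \<le> \<beta> / \<alpha>\<close> assms(2,3) by (intro mult_strict_left_mono power_strict_mono) auto
  also have "\<dots> \<le> g x"
    using real_sqrt_ge_zero[OF \<open>0 \<le> \<beta> / \<alpha>\<close>] assms(2,3)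
    by (intro F_class_ge_outside_unit_ball[OF assms(1)]) linarith+
  finally show ?thesis .
qed

lemma F_class_sum_add_strongly_convex:
  assumes "finite S" "\<And>i. i \<in> S \<Longrightarrow> f i \<in> F_class \<alpha> \<beta>" "h \<in> F_class \<alpha> \<beta>"
  shows "strongly_convex ((real (card S) + 1) * \<alpha>) (\<lambda>x. (\<Sum>i\<in>S. f i x) + h x)"
proof -
  have "strongly_convex (real (card S) * \<alpha>) (\<lambda>x. \<Sum>i\<in>S. f i x)"
    using strongly_convex_sum[OF assms(1) F_class_imp_strongly_convex[OF assms(2)]] by simp
  then show ?thesis
    using strongly_convex_add[OF _ F_class_imp_strongly_convex[OF assms(3)]]
    by (simp add: distrib_right)
qed

lemma F_class_sum_add_norm_arg_min_le:
  assumes "\<And>i. i \<in> S \<Longrightarrow> f i \<in> F_class \<alpha> \<beta>" "h \<in> F_class \<alpha> \<beta>" "0 < \<alpha>"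
    and z: "is_arg_min (\<lambda>x. (\<Sum>i\<in>S. f i x) + h x) (\<lambda>_. True) z"
  shows "norm z \<le> 1 + sqrt (\<beta> / \<alpha>)"
proof (rule ccontr)
  assume "\<not> ?thesis"
  then have less: "g 0 < g z" if "g \<in> F_class \<alpha> \<beta>" for g
    using F_class_at_0_less[OF that assms(3)] by simp
  have "(\<Sum>i\<in>S. f i 0) \<le> (\<Sum>i\<in>S. f i z)"
    using less assms(1) by (intro sum_mono less_imp_le) blast
  then have "(\<Sum>i\<in>S. f i 0) + h 0 < (\<Sum>i\<in>S. f i z) + h z"
    using less[OF assms(2)] by simp
  then show False
    using z by (auto simp: is_arg_min_def)
qed

lemma F_class_dist_le_by_values:
  assumes "g \<in> F_class \<alpha> \<beta>" "h \<in> F_class \<alpha> \<beta>" "norm x \<le> r" "norm y \<le> r"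
    and "0 < \<mu>" "\<mu> * (norm (x - y))\<^sup>2 \<le> exchange_gap g h x y"
  shows "norm (x - y) \<le> sqrt (\<beta> / \<mu>) * (r + 1)"
proof (rule power2_le_imp_le)
  have "0 \<le> \<beta> / \<mu>"
    using F_class_smoothness_nonneg[OF assms(1)] assms(5) by simp
  moreover have "0 \<le> r"
    using norm_ge_zero[of x] assms(3) by linarith
  ultimately show "0 \<le> sqrt (\<beta> / \<mu>) * (r + 1)"
    by simp
  have "\<mu> * (norm (x - y))\<^sup>2 \<le> h x + g y"
    using assms(6) F_class_nonneg[OF assms(1), of x] F_class_nonneg[OF assms(2), of y]
    by (simp add: exchange_gap_def)
  also have "\<dots> \<le> \<beta> * (r + 1)\<^sup>2"
    using F_class_le_on_cball[OF assms(2,3)] F_class_le_on_cball[OF assms(1,4)] by linarith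
  finally have "(norm (x - y))\<^sup>2 \<le> \<beta> / \<mu> * (r + 1)\<^sup>2"
    using assms(5) by (simp add: field_simps)
  then show "(norm (x - y))\<^sup>2 \<le> (sqrt (\<beta> / \<mu>) * (r + 1))\<^sup>2"
    unfolding power_mult_distrib real_sqrt_pow2[OF \<open>0 \<le> \<beta> / \<mu>\<close>] .
qed

lemma F_class_dist_le_by_gradients:
  assumes "g \<in> F_class \<alpha> \<beta>" "h \<in> F_class \<alpha> \<beta>" "norm x \<le> r" "norm y \<le> r"
    and "0 < \<mu>" "\<mu> * (norm (x - y))\<^sup>2 \<le> exchange_gap g h x y"
  shows "norm (x - y) \<le> 2 * (\<beta> / \<mu>) * (r + 1)"
proof (cases "x = y")
  case True
  then show ?thesis
    using F_class_smoothness_nonneg[OF assms(1)] order_trans[OF norm_ge_zero assms(3)] assms(5)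
    by simp
next
  case False
  have lipschitz: "\<bar>u x - u y\<bar> \<le> \<beta> * (r + 1) * norm (x - y)" if "u \<in> F_class \<alpha> \<beta>" for u
    using lipschitz_on_normD[OF F_class_lipschitz_on_cball[OF that], of r x y]
      order_trans[OF norm_ge_zero assms(3)] assms(3,4) by simp
  have "\<mu> * norm (x - y) * norm (x - y) \<le> exchange_gap g h x y"
    using assms(6) by (simp add: power2_eq_square mult.assoc)
  also have "\<dots> \<le> 2 * \<beta> * (r + 1) * norm (x - y)"
    using lipschitz[OF assms(1)] lipschitz[OF assms(2)] by (simp add: exchange_gap_def)
  finally have "\<mu> * norm (x - y) \<le> 2 * \<beta> * (r + 1)"
    by (rule mult_right_le_imp_le) (use False in simp)
  then show ?thesis
    using assms(5) by (simp add: field_simps)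
qed

theorem theorem2:
  fixes \<alpha> \<beta> \<kappa> :: real
    and n :: nat
    and f :: "nat \<Rightarrow> real ^ 'd \<Rightarrow> real"
    and fa fb :: "real ^ 'd \<Rightarrow> real"
    and xa xb :: "real ^ 'd"
  assumes "0 < \<alpha>" and "\<alpha> \<le> \<beta>" and "\<kappa> = \<beta> / \<alpha>" and "2 \<le> n"
    and "\<forall>i\<in>{1..n - 1}. f i \<in> F_class \<alpha> \<beta>"
    and "fa \<in> F_class \<alpha> \<beta>" and "fb \<in> F_class \<alpha> \<beta>"
    and "xa = arg_min (\<lambda>x. (\<Sum>i=1..n - 1. f i x) + fa x) (\<lambda>_. True)"
    and "xb = arg_min (\<lambda>x. (\<Sum>i=1..n - 1. f i x) + fb x) (\<lambda>_. True)"
  shows "norm (xa - xb) \<le>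
    Min {4 + 4 * sqrt \<kappa>,
         (4 * sqrt \<kappa> + 2 * \<kappa>) / sqrt (real n - 1),
         (4 * \<kappa> + 2 * \<kappa> powr (3 / 2)) / real n}"
proof -
  define F where "F = (\<lambda>x. \<Sum>i=1..n - 1. f i x)"
  have \<kappa>: "0 < \<kappa>" and \<mu>: "0 < real n * \<alpha>" and \<kappa>_n: "\<beta> / (real n * \<alpha>) = \<kappa> / real n"
    using assms(1-4) by auto
  have convex: "strongly_convex (real n * \<alpha>) (\<lambda>x. F x + h x)" if "h \<in> F_class \<alpha> \<beta>" for h
    using F_class_sum_add_strongly_convex[of "{1..n - 1}" f \<alpha> \<beta> h] that assms(4,5)
    by (simp add: F_def)
  have arg_min: "is_arg_min (\<lambda>x. F x + fa x) (\<lambda>_. True) xa"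
      "is_arg_min (\<lambda>x. F x + fb x) (\<lambda>_. True) xb"
    using strongly_convex_is_arg_min[OF \<mu> convex] assms(6-9) by (simp_all add: F_def)
  have norm: "norm xa \<le> 1 + sqrt \<kappa>" "norm xb \<le> 1 + sqrt \<kappa>"
    using F_class_sum_add_norm_arg_min_le[of "{1..n - 1}" f] arg_min assms(1,3,5-7)
    unfolding F_def by blast+
  note exchange = strongly_convex_arg_min_exchange[OF convex convex arg_min, OF assms(6,7)]
  have "norm (xa - xb) \<le> 4 + 4 * sqrt \<kappa>"
    using norm_triangle_ineq4[of xa xb] norm real_sqrt_gt_zero[OF \<kappa>] by linarith
  moreover have "norm (xa - xb) \<le> (2 * sqrt \<kappa> + \<kappa>) / sqrt (real n)"
    using F_class_dist_le_by_values[OF assms(6,7) norm \<mu> exchange, unfolded \<kappa>_n] \<kappa>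
    by (simp add: real_sqrt_divide algebra_simps add_divide_distrib)
  moreover have "\<dots> \<le> (4 * sqrt \<kappa> + 2 * \<kappa>) / sqrt (real n - 1)"
    using \<kappa> assms(4) by (intro frac_le) auto
  moreover have "norm (xa - xb) \<le> (4 * \<kappa> + 2 * \<kappa> powr (3 / 2)) / real n"
    using F_class_dist_le_by_gradients[OF assms(6,7) norm \<mu> exchange, unfolded \<kappa>_n] \<kappa>
      powr_add[of \<kappa> 1 "1 / 2"]
    by (simp add: powr_half_sqrt algebra_simps add_divide_distrib)
  ultimately show ?thesis
    by simp
qed

end
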